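(* Let $$C(t,u,z)=\sum_{n\ge 1}\ \sum_{k,m\ge 0}\bigl|\{\pi\in\mathcal{S}_n(312,4321) : \operatorname{fp}(\pi)=m,\ \operatorname{cyc}(\pi)=k\}\bigr|\,t^ku^mz^n,$$ a formal power series in $z$ with coefficients in $\mathbb{Z}[t,u]$. Then $$C(t,u,z)=\frac{tuz+tz^2(1-u)+tuz^3(t-tu-1)+t^2z^5(1-u)^2}{1-z(1+tu)-z^2(1+t)+tuz^3(1+tu-t)+tz^4(u-1)-t^2z^5(1-u)^2}.$$
   Context: $\mathcal{S}_n$ is the set of permutations of $[n]=\{1,\dots,n\}$; $\pi\in\mathcal{S}_n$ is written in one-line notation as $\pi=\pi_1\pi_2\cdots\pi_n$ with $\pi_i=\pi(i)$. A permutation $\pi\in\mathcal{S}_n$ contains a pattern $\sigma\in\mathcal{S}_r$ if there are indices $i_1<\dots<i_r$ such that $\pi_{i_1}\cdots\pi_{i_r}$ is in the same relative order as $\sigma$; otherwise $\pi$ avoids $\sigma$. $\mathcal{S}_n(312,4321)$ is the set of $\pi\in\mathcal{S}_n$ avoiding both patterns $312$ and $4321$. $\operatorname{cyc}(\pi)$ is the number of cycles in the disjoint cycle decomposition of $\pi$ (fixed points counted as cycles); $\operatorname{fp}(\pi)$ is the number of fixed points, i.e. of $i$ with $\pi_i=i$. *)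

theory Defs
  imports
    "HOL-Combinatorics.Orbits"
    "HOL-Computational_Algebra.Polynomial"
    "HOL-Computational_Algebra.Formal_Power_Series"
    "HOL-Library.Groups_Big_Fun"
begin

(* A permutation of [n] is a function p with p permutes {1..n}; a pattern is a list in
   one-line notation. The list js holds the positions of the occurrence. *)
definition contains_pattern :: "nat \<Rightarrow> (nat \<Rightarrow> nat) \<Rightarrow> nat list \<Rightarrow> bool" where
  "contains_pattern n p s \<longleftrightarrow>
     (\<exists>js. length js = length s \<and> sorted_wrt (<) js \<and> set js \<subseteq> {1..n} \<and>
       (\<forall>a<length s. \<forall>b<length s. p (js ! a) < p (js ! b) \<longleftrightarrow> s ! a < s ! b))"

definition avoiders :: "nat \<Rightarrow> nat list set \<Rightarrow> (nat \<Rightarrow> nat) set" where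
  "avoiders n B = {p. p permutes {1..n} \<and> (\<forall>s\<in>B. \<not> contains_pattern n p s)}"

(* The cycles are the orbits of the points of {1..n}, so fixed points count as cycles. *)
definition cyc :: "nat \<Rightarrow> (nat \<Rightarrow> nat) \<Rightarrow> nat" where
  "cyc n p = card (orbit p ` {1..n})"

definition fp :: "nat \<Rightarrow> (nat \<Rightarrow> nat) \<Rightarrow> nat" where
  "fp n p = card {i \<in> {1..n}. p i = i}"

definition avoider_count :: "nat \<Rightarrow> nat \<Rightarrow> nat \<Rightarrow> nat" where
  "avoider_count n k m =
     card {p \<in> avoiders n {[3,1,2], [4,3,2,1]}. fp n p = m \<and> cyc n p = k}"

(* The ring of integer polynomials in t and u is modelled as int poly poly:
   t is the inner and u the outer indeterminate. *)
definition t_var :: "int poly poly" where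
  "t_var = [:[:0, 1:]:]"

definition u_var :: "int poly poly" where
  "u_var = [:0, 1:]"

lemma cyc_le: "cyc n p \<le> n"
  unfolding cyc_def by (rule order_trans[OF card_image_le]) auto

lemma fp_le: "fp n p \<le> n"
  unfolding fp_def by (rule order_trans[OF card_mono[of "{1..n}"]]) auto

lemma avoider_count_eq_0: "avoider_count n k m = 0" if "k > n \<or> m > n"
proof -
  have "{p \<in> avoiders n {[3,1,2], [4,3,2,1]}. fp n p = m \<and> cyc n p = k} = {}"
    using that cyc_le[of n] fp_le[of n] by (auto simp: not_less[symmetric])
  then show ?thesis unfolding avoider_count_def by (simp only: card.empty)
qed

(* The sums over all k and m have finite support by avoider_count_eq_0, so Sum_any is the
   genuine sum (it would be 0 on an infinite support). *)
definition C_gf :: "int poly poly fps" where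
  "C_gf = Abs_fps (\<lambda>n. if n \<ge> 1
     then Sum_any (\<lambda>k. Sum_any (\<lambda>m. of_nat (avoider_count n k m) * t_var ^ k * u_var ^ m))
     else 0)"

(* Division in a power series ring over a commutative ring, for a divisor with constant
   coefficient 1: fps_right_inverse g y is the inverse of g when fps_nth g 0 * y = 1. *)
definition fps_quot :: "'a::comm_ring_1 fps \<Rightarrow> 'a fps \<Rightarrow> 'a fps" where
  "fps_quot f g = f * fps_right_inverse g 1"

lemma fps_quot_mult:
  assumes "fps_nth g 0 = 1"
  shows "fps_quot f g * g = f"
  using fps_right_inverse[of g 1] assms unfolding fps_quot_def
  by (simp add: mult.left_commute mult.commute[of _ g])

end

theory Submission
  imports Defs
begin

text \<open>
  Let \<open>p\<close> be a nonempty avoider. If \<open>p 1 = 1\<close>, then \<open>p\<close> is an arbitrary avoider of size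
  \<open>n - 1\<close> with a fixed point put in front. Otherwise the value \<open>2\<close>, at position \<open>k\<close> say,
  precedes the value \<open>1\<close>; avoidance forces the first \<open>k\<close> entries to be \<open>3 4 \<dots> (k+1) 2\<close>, and
  deleting them leaves an arbitrary nonempty avoider \<open>q\<close> of size \<open>n - k\<close>. This adds one cycle
  exactly if \<open>k\<close> is even, creates a fixed point exactly if \<open>k = 2\<close>, and destroys the
  fixed point \<open>1\<close> of \<open>q\<close>, if there is one. With \<open>W = 1 + C\<close>, with \<open>G\<close> counting the avoiders that move \<open>1\<close>,
  with \<open>H\<close> counting nonempty avoiders without regard to the fixed point \<open>1\<close>, and with
  \<open>L = (z + t z\<^sup>2)/(1 - z\<^sup>2) + t (u - 1) z\<^sup>2\<close>, this says \<open>W = 1 + t u z W + G\<close>, \<open>H = t z W + G\<close> and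
  \<open>G = L H\<close>, from which \<open>C\<close> is obtained by elimination.
\<close>

section \<open>Avoidance as inequalities between entries\<close>

lemma contains_312_iff:
  "contains_pattern n p [3,1,2] \<longleftrightarrow>
    (\<exists>a b c. 1 \<le> a \<and> a < b \<and> b < c \<and> c \<le> n \<and> p b < p c \<and> p c < p a)" (is "?L \<longleftrightarrow> ?R")
proof
  assume ?L
  then obtain js where js: "length js = Suc (Suc (Suc 0))" "sorted_wrt (<) js" "set js \<subseteq> {1..n}"
    "\<forall>a<length [3,1,2::nat]. \<forall>b<length [3,1,2::nat]. p (js ! a) < p (js ! b) \<longleftrightarrow> [3,1,2::nat] ! a < [3,1,2] ! b"
    unfolding contains_pattern_def by auto
  from js(1) obtain a b c where "js = [a,b,c]"
    by (auto simp: length_Suc_conv)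
  with js(2-) have "1 \<le> a" "a < b" "b < c" "c \<le> n" "p b < p c" "p c < p a"
    by (auto simp: All_less_Suc)
  then show ?R by blast
next
  assume ?R
  then obtain a b c where "1 \<le> a" "a < b" "b < c" "c \<le> n" "p b < p c" "p c < p a"
    by blast
  then show ?L unfolding contains_pattern_def
    by (intro exI[of _ "[a,b,c]"]) (auto simp: All_less_Suc)
qed

lemma contains_4321_iff:
  "contains_pattern n p [4,3,2,1] \<longleftrightarrow>
    (\<exists>a b c d. 1 \<le> a \<and> a < b \<and> b < c \<and> c < d \<and> d \<le> n \<and> p d < p c \<and> p c < p b \<and> p b < p a)"
    (is "?L \<longleftrightarrow> ?R")
proof
  assume ?L
  then obtain js where js: "length js = Suc (Suc (Suc (Suc 0)))" "sorted_wrt (<) js" "set js \<subseteq> {1..n}"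
    "\<forall>a<length [4,3,2,1::nat]. \<forall>b<length [4,3,2,1::nat]. p (js ! a) < p (js ! b) \<longleftrightarrow> [4,3,2,1::nat] ! a < [4,3,2,1] ! b"
    unfolding contains_pattern_def by auto
  from js(1) obtain a b c d where "js = [a,b,c,d]"
    by (auto simp: length_Suc_conv)
  with js(2-) have "1 \<le> a" "a < b" "b < c" "c < d" "d \<le> n" "p d < p c" "p c < p b" "p b < p a"
    by (auto simp: All_less_Suc)
  then show ?R by blast
next
  assume ?R
  then obtain a b c d where "1 \<le> a" "a < b" "b < c" "c < d" "d \<le> n" "p d < p c" "p c < p b" "p b < p a"
    by blast
  then show ?L unfolding contains_pattern_def
    by (intro exI[of _ "[a,b,c,d]"]) (auto simp: All_less_Suc)
qed

definition av :: "nat \<Rightarrow> (nat \<Rightarrow> nat) set" where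
  "av n = avoiders n {[3,1,2], [4,3,2,1]}"

lemma avI:
  assumes "p permutes {1..n}"
    and "\<And>a b c. \<lbrakk>1 \<le> a; a < b; b < c; c \<le> n; p b < p c; p c < p a\<rbrakk> \<Longrightarrow> False"
    and "\<And>a b c d. \<lbrakk>1 \<le> a; a < b; b < c; c < d; d \<le> n; p d < p c; p c < p b; p b < p a\<rbrakk> \<Longrightarrow> False"
  shows "p \<in> av n"
  unfolding av_def avoiders_def using assms by (simp add: contains_312_iff contains_4321_iff del: One_nat_def) blast

lemma avD:
  assumes "p \<in> av n"
  shows av_permutes: "p permutes {1..n}"
    and av_312: "\<lbrakk>1 \<le> a; a < b; b < c; c \<le> n; p b < p c; p c < p a\<rbrakk> \<Longrightarrow> False"
    and av_4321: "\<lbrakk>1 \<le> a; a < b; b < c; c < d; d \<le> n; p d < p c; p c < p b; p b < p a\<rbrakk> \<Longrightarrow> False"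
  using assms unfolding av_def avoiders_def
  by (simp_all add: contains_312_iff contains_4321_iff del: One_nat_def)

text \<open>An occurrence of a pattern in \<open>q\<close>, moved \<open>k\<close> positions to the
  right, is an occurrence in \<open>p\<close>. This shows that what is left after deleting an
  initial segment still avoids both patterns.\<close>

lemma av_transfer:
  assumes "p \<in> av m" "q permutes {1..n}" "n + k \<le> m"
    and "\<And>i j. \<lbrakk>1 \<le> i; i \<le> n; 1 \<le> j; j \<le> n; q i < q j\<rbrakk> \<Longrightarrow> p (i + k) < p (j + k)"
  shows "q \<in> av n"
proof (rule avI)
  fix a b c assume "1 \<le> a" "a < b" "b < c" "c \<le> n" "q b < q c" "q c < q a"
  then show False using assms(3)
    by (intro av_312[OF assms(1), of "a + k" "b + k" "c + k"] assms(4)) auto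
next
  fix a b c d assume "1 \<le> a" "a < b" "b < c" "c < d" "d \<le> n" "q d < q c" "q c < q b" "q b < q a"
  then show False using assms(3)
    by (intro av_4321[OF assms(1), of "a + k" "b + k" "c + k" "d + k"] assms(4)) auto
qed (rule assms(2))

lemma permutes_atLeastAtMostI:
  assumes "inj_on p {1..n}" "\<And>i. \<lbrakk>1 \<le> i; i \<le> n\<rbrakk> \<Longrightarrow> 1 \<le> p i \<and> p i \<le> n"
    and "\<And>i. i \<notin> {1..n} \<Longrightarrow> p i = i"
  shows "p permutes {1..n::nat}"
proof (rule bij_imp_permutes)
  have "p ` {1..n} = {1..n}"
    by (rule endo_inj_surj) (use assms in auto)
  then show "bij_betw p {1..n} {1..n}" using assms(1) by (simp add: bij_betw_def)
qed (use assms(3) in auto)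

section \<open>Prepending a fixed point or a layer, and the inverse decompositions\<close>

definition inc :: "(nat \<Rightarrow> nat) \<Rightarrow> nat \<Rightarrow> nat" where
  "inc q i = (if i \<le> 1 then i else q (i - 1) + 1)"

text \<open>In one-line notation: the word \<open>3 4 \<dots> (k+1) 2\<close>, followed by \<open>q\<close> with every value
  but the value \<open>1\<close> raised by \<open>k\<close>.\<close>
definition lay :: "nat \<Rightarrow> (nat \<Rightarrow> nat) \<Rightarrow> nat \<Rightarrow> nat" where
  "lay k q i = (if i = 0 then 0 else if i < k then i + 2 else if i = k then 2
     else if q (i - k) = 1 then 1 else q (i - k) + k)"

lemma perm_range:
  assumes "q permutes {1..n::nat}"
  shows "0 < i \<Longrightarrow> 0 < q i" "i \<le> n \<Longrightarrow> q i \<le> n" "q 0 = 0" "n < i \<Longrightarrow> q i = i"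
proof -
  show 0: "q 0 = 0" using permutes_not_in[OF assms, of 0] by simp
  show "n < i \<Longrightarrow> q i = i" using permutes_not_in[OF assms, of i] by simp
  show "0 < i \<Longrightarrow> 0 < q i"
    using permutes_inj[OF assms] 0 by (metis inj_eq neq0_conv)
  show "i \<le> n \<Longrightarrow> q i \<le> n"
    using permutes_in_image[OF assms, of i] 0 by (cases "i = 0") auto
qed

lemma perm_eq_iff: "q permutes S \<Longrightarrow> q i = q j \<longleftrightarrow> i = j"
  by (meson permutes_inj inj_eq)

lemma lay_tail: "k < i \<Longrightarrow> lay k q i = (if q (i - k) = 1 then 1 else q (i - k) + k)"
  by (simp add: lay_def)

lemma raise_eq_iff:
  "0 < a \<Longrightarrow> 0 < b \<Longrightarrow> (if a = 1 then 1 else a + k) = (if b = 1 then 1 else b + k) \<longleftrightarrow> a = b"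
  for a b k :: nat
  by auto

text \<open>The first \<open>k\<close> entries take the values from 2 to \<open>k + 1\<close>, the
  later ones the value 1 and values from \<open>k + 2\<close> on, so the two blocks cannot
  collide.\<close>

lemma lay_permutes:
  assumes q: "q permutes {1..n}" and "1 \<le> n" "1 \<le> k"
  shows "lay k q permutes {1..n + k}"
proof (rule permutes_atLeastAtMostI)
  note R = perm_range[OF q]
  show "inj_on (lay k q) {1..n + k}"
  proof (rule inj_onI)
    fix i j assume ij: "i \<in> {1..n+k}" "j \<in> {1..n+k}" "lay k q i = lay k q j"
    have pos: "i > k \<Longrightarrow> 0 < q (i - k)" "j > k \<Longrightarrow> 0 < q (j - k)" using R(1) by auto
    show "i = j"
    proof (cases "k < i \<and> k < j")
      case True
      then have "q (i - k) = q (j - k)"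
        using ij(3) pos raise_eq_iff unfolding lay_tail[OF conjunct1[OF True]] lay_tail[OF conjunct2[OF True]]
        by blast
      then show ?thesis using True perm_eq_iff[OF q, of "i - k" "j - k"] by linarith
    next
      case False
      then show ?thesis using ij pos
        by (cases "k < i"; cases "k < j") (simp_all add: lay_def split: if_splits)
    qed
  qed
  show "1 \<le> lay k q i \<and> lay k q i \<le> n + k" if "1 \<le> i" "i \<le> n + k" for i
    using R(1,2)[of "i - k"] that assms(2,3) by (auto simp: lay_def)
  show "lay k q i = i" if "i \<notin> {1..n + k}" for i
  proof (cases "i = 0")
    case False
    then have "n + k < i" using that by simp
    \<comment> \<open>Since \<open>q\<close> is nonempty, \<open>i - k\<close> exceeds 1, so the
      clause for the value 1 does not apply here.\<close>
    then have "k < i" "q (i - k) = i - k" "i - k \<noteq> 1" using R(4)[of "i - k"] assms(2) by auto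
    then show ?thesis by (simp add: lay_tail)
  qed (simp add: lay_def)
qed

lemma lay_tail_less_iff:
  assumes "q permutes {1..n}" "k < i" "k < j"
  shows "lay k q i < lay k q j \<longleftrightarrow> q (i - k) < q (j - k)"
  using perm_range(1)[OF assms(1), of "i - k"] perm_range(1)[OF assms(1), of "j - k"] assms(2,3)
  by (auto simp: lay_def)

text \<open>An occurrence starting after position \<open>k\<close> comes from one in
  \<open>q\<close>. To the right of an entry among the first \<open>k\<close>, the only smaller
  values can be 2 and then 1: they decrease, which excludes 312, and they are at most two, which
  excludes 4321.\<close>

lemma lay_in_av:
  assumes q: "q \<in> av n" and n: "1 \<le> n" and k: "1 \<le> k"
  shows "lay k q \<in> av (n + k)"
proof (rule avI)
  note P = av_permutes[OF q]
  note R = perm_range[OF P]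
  have big: "lay k q i = 1 \<or> lay k q i \<ge> k + 2" if "i > k" for i
    using that R(1)[of "i - k"] by (auto simp: lay_def)
  have small: "lay k q i = (if i < k then i + 2 else 2)" if "1 \<le> i" "i \<le> k" for i
    using that by (auto simp: lay_def)
  show L: "lay k q permutes {1..n + k}" by (rule lay_permutes[OF P n k])
  have pos: "0 < lay k q i" if "0 < i" for i using perm_range(1)[OF L] that by blast
  show False if h: "1 \<le> a" "a < b" "b < c" "c \<le> n + k" "lay k q b < lay k q c" "lay k q c < lay k q a" for a b c
  proof (cases "k < a")
    case True
    then show False using h lay_tail_less_iff[OF P]
      by (intro av_312[OF q, of "a - k" "b - k" "c - k"]) auto
  next
    case False
    then show False using h small[of a] small[of b] small[of c] big[of b] big[of c] pos[of b] 
      by (cases "b \<le> k"; cases "c \<le> k") (auto split: if_splits)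
  qed
  show False if h: "1 \<le> a" "a < b" "b < c" "c < d" "d \<le> n + k"
      "lay k q d < lay k q c" "lay k q c < lay k q b" "lay k q b < lay k q a" for a b c d
  proof (cases "k < a")
    case True
    then show False using h lay_tail_less_iff[OF P]
      by (intro av_4321[OF q, of "a - k" "b - k" "c - k" "d - k"]) auto
  next
    case False
    then show False using h small[of a] small[of b] small[of c] big[of b] big[of c] pos[of d]
      by (cases "b \<le> k"; cases "c \<le> k") (auto split: if_splits)
  qed
qed

lemma lay_inj:
  assumes "q permutes {1..n}" "q' permutes {1..n'}" "lay k q = lay k q'" "1 \<le> k"
  shows "q = q'"
proof
  fix i
  show "q i = q' i"
  proof (cases "i = 0")
    case False
    then have "lay k f (i + k) = (if f i = 1 then 1 else f i + k)" for f
      by (simp add: lay_def)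
    then have "(if q i = 1 then 1 else q i + k) = (if q' i = 1 then 1 else q' i + k)"
      using fun_cong[OF assms(3), of "i + k"] by metis
    moreover have "0 < q i" "0 < q' i" using False perm_range(1)[OF assms(1)] perm_range(1)[OF assms(2)] by auto
    ultimately show ?thesis using raise_eq_iff by blast
  qed (use perm_range(3)[OF assms(1)] perm_range(3)[OF assms(2)] in simp)
qed

text \<open>Here \<open>k\<close> is the position of the value 2 and \<open>j\<close> that of the
  value 1. Everything before \<open>k\<close> is then forced, and \<open>q\<close> is read off from
  what follows \<open>k\<close>.\<close>

lemma av_eq_lay:
  assumes p: "p \<in> av n" and n: "1 \<le> n" and p1: "p 1 \<noteq> 1"
  obtains k q where "1 \<le> k" "k < n" "q \<in> av (n - k)" "p = lay k q"
proof -
  note P = av_permutes[OF p]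
  note R = perm_range[OF P]
  have ex: "\<exists>i. 1 \<le> i \<and> i \<le> n \<and> p i = v" if "1 \<le> v" "v \<le> n" for v
    using permutes_surj[OF P] that R by (metis not_less surjD less_one)
  have inj: "p i = p j \<longleftrightarrow> i = j" for i j by (rule perm_eq_iff[OF P])
  obtain j where j: "1 \<le> j" "j \<le> n" "p j = 1" using ex[of 1] n by auto
  have "j \<noteq> 1" using p1 j by auto
  then have n2: "2 \<le> n" using j by auto
  then obtain k where k: "1 \<le> k" "k \<le> n" "p k = 2" using ex[of 2] by auto
  have kj: "k < j"
  proof (rule ccontr)
    assume "\<not> k < j"
    then have "j < k" using j k by (metis linorder_cases numeral_eq_one_iff semiring_norm(85))
    \<comment> \<open>The values 1 and 2 sit at \<open>j\<close> and \<open>k\<close>, both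
      different from position 1, so positions 1, \<open>j\<close>, \<open>k\<close> would form a
      312.\<close>
    moreover have "p 1 > 2" using R(1)[of 1] p1 inj[of 1 k] k \<open>j \<noteq> 1\<close> j \<open>j < k\<close> by simp
    ultimately show False using j k \<open>j \<noteq> 1\<close> by (intro av_312[OF p, of 1 j k]) auto
  qed
  have init: "p i = i + 2" if "1 \<le> i" "i < k" for i using that
  proof (induction i rule: less_induct)
    case (less i)
    \<comment> \<open>The value \<open>i + 2\<close> occurs because
      \<open>i < k < j \<le> n\<close>.\<close>
    obtain c where c: "1 \<le> c" "c \<le> n" "p c = i + 2" using ex[of "i + 2"] less.prems k kj j by auto
    have "p i \<ge> i + 2"
    proof (rule ccontr)
      assume "\<not> i + 2 \<le> p i"
      then consider "p i = 1" | "p i = 2" | "p i \<ge> 3" "p i < i + 2" using R(1)[of i] less.prems by linarith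
      then show False
      proof cases
        \<comment> \<open>By induction this value already stands at the earlier position
          \<open>p i - 2\<close>.\<close>
        case 3
        then have "p (p i - 2) = p i" using less.IH[of "p i - 2"] less.prems by auto
        then have "p i - 2 = i" using inj by blast
        then show False using 3 by linarith
      qed (use inj[of i j] inj[of i k] j k less.prems kj in auto)
    qed
    moreover have "p i \<le> i + 2"
    proof (rule ccontr)
      assume gt: "\<not> p i \<le> i + 2"
      then have "c \<noteq> i" using c by auto
      moreover have "c \<noteq> k" using c k less.prems by auto
      moreover have "\<not> c < i" using less.IH[of c] less.prems c by auto
      ultimately consider "c > k" | "i < c" "c < k" by linarith
      then show False
      proof cases
        case 1
        \<comment> \<open>The entries \<open>p i\<close>, 2, \<open>i + 2\<close> form a
          312.\<close>
        then show False using gt c k less.prems by (intro av_312[OF p, of i k c]) auto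
      next
        case 2
        \<comment> \<open>The entries \<open>p i\<close>, \<open>i + 2\<close>, 2, 1 form a
          4321.\<close>
        then show False using gt c k less.prems kj j by (intro av_4321[OF p, of i c k j]) auto
      qed
    qed
    ultimately show ?case by simp
  qed
  \<comment> \<open>The values from 2 to \<open>k + 1\<close> are used up by the first
    \<open>k\<close> positions.\<close>
  have tail: "p i = 1 \<or> p i \<ge> k + 2" if "k < i" for i
  proof (rule ccontr)
    assume h: "\<not> (p i = 1 \<or> p i \<ge> k + 2)"
    then have "p i \<noteq> 2" "p i \<ge> 1" using inj[of i k] k that R(1)[of i] by auto
    then have "p (p i - 2) = p i" using init[of "p i - 2"] h by auto
    then have "p i - 2 = i" using inj by blast
    moreover have "2 \<le> p i" using h \<open>p i \<noteq> 2\<close> \<open>p i \<ge> 1\<close> by linarith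
    ultimately show False using h that by linarith
  qed
  \<comment> \<open>The point 0 needs its own clause: the shifted index would read position
    \<open>k\<close>. By \<open>tail\<close>, the subtraction does not truncate for
    \<open>1 \<le> i\<close>.\<close>
  define q where "q i = (if i = 0 then 0 else if p (i + k) = 1 then 1 else p (i + k) - k)" for i
  have tail': "p (i + k) = (if q i = 1 then 1 else q i + k) \<and> 1 \<le> q i" if "1 \<le> i" for i
    using tail[of "i + k"] that by (auto simp: q_def)
  have pq: "p = lay k q"
  proof
    fix i
    show "p i = lay k q i"
      using init[of i] k(3) R(3) tail'[of "i - k"] by (auto simp: lay_def)
  qed
  have q: "q permutes {1..n - k}"
  proof (rule permutes_atLeastAtMostI)
    show "inj_on q {1..n - k}"
      by (rule inj_onI) (metis atLeastAtMost_iff tail' inj add_right_cancel)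
    show "1 \<le> q i \<and> q i \<le> n - k" if "1 \<le> i" "i \<le> n - k" for i
    proof -
      have "p (i + k) \<le> n" using R(2) that k by simp
      then show ?thesis using tail'[OF that(1)] that by (cases "q i = 1") auto
    qed
    show "q i = i" if "i \<notin> {1..n - k}" for i
    proof (cases "i = 0")
      case False
      then have "n < i + k" using that by auto
      then have "p (i + k) = i + k" "i + k \<noteq> 1" using R(4) n by auto
      then show ?thesis using False by (simp add: q_def)
    qed (simp add: q_def)
  qed
  have "q \<in> av (n - k)"
    by (rule av_transfer[OF p q, of k]) (use k lay_tail_less_iff[OF q] in \<open>auto simp: pq\<close>)
  then show ?thesis using that k kj j pq by auto
qed

lemma inc_permutes:
  assumes q: "q permutes {1..n}"
  shows "inc q permutes {1..Suc n}"
proof (rule permutes_atLeastAtMostI)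
  note R = perm_range[OF q]
  show "inj_on (inc q) {1..Suc n}"
  proof (rule inj_onI)
    fix i j assume ij: "i \<in> {1..Suc n}" "j \<in> {1..Suc n}" "inc q i = inc q j"
    then show "i = j" using R(1)[of "i - 1"] R(1)[of "j - 1"] perm_eq_iff[OF q, of "i - 1" "j - 1"]
      by (auto simp: inc_def split: if_splits)
  qed
  show "1 \<le> inc q i \<and> inc q i \<le> Suc n" if "1 \<le> i" "i \<le> Suc n" for i
    using R(1,2)[of "i - 1"] that by (auto simp: inc_def)
  show "inc q i = i" if "i \<notin> {1..Suc n}" for i
    using R(4)[of "i - 1"] that by (auto simp: inc_def)
qed

text \<open>Both patterns start with an entry larger than a later one, so the leading value 1 cannot
  start an occurrence, and every occurrence lies in the shifted copy of \<open>q\<close>.\<close>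

lemma inc_in_av:
  assumes q: "q \<in> av n"
  shows "inc q \<in> av (Suc n)"
proof (rule avI)
  note P = av_permutes[OF q]
  have less: "inc q i < inc q j \<longleftrightarrow> q (i - 1) < q (j - 1)" if "1 \<le> i" "1 \<le> j" for i j
    using that perm_range(1,3)[OF P] by (auto simp: inc_def)
  show "inc q permutes {1..Suc n}" by (rule inc_permutes[OF P])
  show False if h: "1 \<le> a" "a < b" "b < c" "c \<le> Suc n" "inc q b < inc q c" "inc q c < inc q a" for a b c
  proof (cases "a = 1")
    case False
    then show False using h less by (intro av_312[OF q, of "a - 1" "b - 1" "c - 1"]) auto
  qed (use h in \<open>auto simp: inc_def\<close>)
  show False if h: "1 \<le> a" "a < b" "b < c" "c < d" "d \<le> Suc n"
      "inc q d < inc q c" "inc q c < inc q b" "inc q b < inc q a" for a b c d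
  proof (cases "a = 1")
    case False
    then show False using h less by (intro av_4321[OF q, of "a - 1" "b - 1" "c - 1" "d - 1"]) auto
  qed (use h in \<open>auto simp: inc_def\<close>)
qed

lemma inc_inj:
  assumes "q permutes {1..n}" "q' permutes {1..n'}" "inc q = inc q'"
  shows "q = q'"
proof
  fix i
  show "q i = q' i"
    using fun_cong[OF assms(3), of "i + 1"] perm_range(3)[OF assms(1)] perm_range(3)[OF assms(2)]
    by (cases "i = 0") (auto simp: inc_def)
qed

lemma av_eq_inc:
  assumes p: "p \<in> av (Suc n)" and p1: "p 1 = 1"
  obtains q where "q \<in> av n" "p = inc q"
proof -
  note P = av_permutes[OF p]
  note R = perm_range[OF P]
  define q where "q i = p (i + 1) - 1" for i
  have two: "2 \<le> p i" if "2 \<le> i" for i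
  proof -
    have "p i \<noteq> 1" using perm_eq_iff[OF P, of i 1] p1 that by simp
    then show ?thesis using R(1)[of i] that by linarith
  qed
  have tail: "p (i + 1) = q i + 1 \<and> 1 \<le> q i" if "1 \<le> i" for i
    using two[of "i + 1"] that unfolding q_def by linarith
  have pq: "p = inc q"
  proof
    fix i
    show "p i = inc q i"
    proof (cases "i \<le> 1")
      case True
      then have "i = 0 \<or> i = 1" by linarith
      then show ?thesis using R(3) p1 by (auto simp: inc_def)
    next
      case False
      then show ?thesis using tail[of "i - 1"] by (simp add: inc_def)
    qed
  qed
  have q: "q permutes {1..n}"
  proof (rule permutes_atLeastAtMostI)
    show "inj_on q {1..n}"
      by (rule inj_onI) (use tail perm_eq_iff[OF P] in \<open>metis atLeastAtMost_iff add_right_cancel\<close>)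
    show "1 \<le> q i \<and> q i \<le> n" if "1 \<le> i" "i \<le> n" for i
      using tail[of i] that R(2)[of "i + 1"] by auto
    show "q i = i" if "i \<notin> {1..n}" for i
      using that R(4)[of "i + 1"] p1 by (cases "i = 0") (auto simp: q_def)
  qed
  have "q \<in> av n"
    by (rule av_transfer[OF p q, of 1]) (use tail in auto)
  then show ?thesis using that pq by auto
qed

section \<open>Numbers of orbits under conjugation, bypassing a point, and removing a fixed
  point\<close>

text \<open>The map \<open>f\<close> carries orbits onto orbits, and distinct subsets of
  \<open>S\<close> have distinct images under it.\<close>

lemma card_orbits_conjugate:
  assumes f: "inj_on f S" and p: "p ` S \<subseteq> S" and eq: "\<And>x. x \<in> S \<Longrightarrow> q (f x) = f (p x)"
  shows "card (orbit q ` f ` S) = card (orbit p ` S)"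
proof -
  have sub: "orbit p x \<subseteq> S" if "x \<in> S" for x
  proof
    fix y assume "y \<in> orbit p x"
    then show "y \<in> S" by induction (use p that in auto)
  qed
  have orb: "orbit q (f x) = f ` orbit p x" if x: "x \<in> S" for x
  proof (intro set_eqI iffI)
    fix y assume "y \<in> orbit q (f x)"
    then show "y \<in> f ` orbit p x"
    proof induction
      case base
      then show ?case using eq x by (auto intro: orbit.base)
    next
      case (step y)
      then obtain w where "w \<in> orbit p x" "y = f w" by auto
      then show ?case using eq[of w] sub x by (auto intro: orbit.step)
    qed
  next
    fix y assume "y \<in> f ` orbit p x"
    then obtain w where w: "y = f w" "w \<in> orbit p x" by auto
    from w(2) have "f w \<in> orbit q (f x)"
    proof induction
      case base
      then show ?case using eq[OF x] by (metis orbit.base)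
    next
      case (step w)
      then have "w \<in> S" using sub x by auto
      then have "f (p w) = q (f w)" using eq by simp
      then show ?case using step by (simp add: orbit.step)
    qed
    then show "y \<in> orbit q (f x)" using w by simp
  qed
  have "orbit q ` f ` S = image f ` (orbit p ` S)"
    using orb by (auto simp: image_image)
  moreover have "inj_on (image f) (orbit p ` S)"
    by (rule inj_onI) (use sub f in \<open>auto simp: inj_on_image_eq_iff\<close>)
  ultimately show ?thesis by (simp add: card_image)
qed

text \<open>The new map sends the predecessor of \<open>x\<close> straight to \<open>p x\<close>.
  Only \<open>x\<close> is lost from its orbit, which survives as \<open>x\<close> is not fixed.
  Injectivity is asked on \<open>S\<close> only, since the bypassing map, to which the lemma is
  applied again, still takes the value \<open>p x\<close> at \<open>x\<close> itself.\<close>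

lemma card_orbits_contract:
  assumes inj: "inj_on p S" and p: "p ` S \<subseteq> S" and fin: "finite S"
    and x: "x \<in> S" "p x \<noteq> x"
  shows "card (orbit (\<lambda>y. if p y = x then p x else p y) ` (S - {x})) = card (orbit p ` S)"
proof -
  define q where "q y = (if p y = x then p x else p y)" for y
  have sub: "orbit p y \<subseteq> S" if "y \<in> S" for y
  proof
    fix z assume "z \<in> orbit p y"
    then show "z \<in> S" by induction (use p that in auto)
  qed
  \<comment> \<open>\<open>orbit p y\<close> starts at \<open>p y\<close>, so that it contains
    \<open>y\<close> needs an argument: \<open>p\<close> agrees on \<open>S\<close> with a
    permutation of a finite set.\<close>
  define P where "P = perm_restrict p S"
  have P: "P permutes S"
  proof (rule bij_imp_permutes)
    have "P ` S = p ` S" by (auto simp: P_def perm_restrict_def)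
    also have "\<dots> = S" by (rule endo_inj_surj[OF fin p inj])
    finally show "bij_betw P S S" using inj
      by (auto simp: bij_betw_def P_def perm_restrict_def inj_on_def)
  qed (simp add: P_def perm_restrict_def)
  have self: "y \<in> orbit p y" if "y \<in> S" for y
  proof -
    have "orbit p y = orbit P y"
      by (rule orbit_cong0[of _ S]) (use that p in \<open>auto simp: P_def perm_restrict_def\<close>)
    then show ?thesis
      using permutation_self_in_orbit[of P y] P fin by (auto simp: permutation_permutes)
  qed
  have orb: "orbit q y = orbit p y - {x}" if y: "y \<in> S" "y \<noteq> x" for y
  proof (intro set_eqI iffI)
    fix z assume "z \<in> orbit q y"
    then show "z \<in> orbit p y - {x}"
    proof induction
      case base
      show ?case using x orbit.base[of p y] orbit.step[of x p y] by (auto simp: q_def)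
    next
      case (step z)
      then show ?case using x orbit.step[of z p y] orbit.step[of x p y] by (auto simp: q_def)
    qed
  next
    fix z assume z: "z \<in> orbit p y - {x}"
    \<comment> \<open>Invariant along the orbit: where \<open>p\<close> visits \<open>x\<close>, the
      map \<open>q\<close> has already jumped to \<open>p x\<close>.\<close>
    have "(z \<noteq> x \<longrightarrow> z \<in> orbit q y) \<and> (z = x \<longrightarrow> p x \<in> orbit q y)" if "z \<in> orbit p y"
      using that
    proof induction
      case base
      show ?case using orbit.base[of q y] by (auto simp: q_def[of y])
    next
      case (step z)
      then show ?case using orbit.step[of z q y] x by (cases "z = x") (auto simp: q_def[of z])
    qed
    then show "z \<in> orbit q y" using z by auto
  qed
  \<comment> \<open>The orbit of \<open>x\<close> is also indexed by \<open>p x\<close>, so dropping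
    the index \<open>x\<close> loses no orbit.\<close>
  have "orbit p x = orbit p (p x)" using self_in_orbit_step[OF self[OF x(1)]] by simp
  moreover have "p x \<in> S - {x}" using p x by auto
  ultimately have "orbit p ` S = orbit p ` (S - {x})" using x(1) by auto
  moreover have "card (orbit q ` (S - {x})) = card (orbit p ` (S - {x}))"
  proof -
    have "orbit q ` (S - {x}) = (\<lambda>A. A - {x}) ` orbit p ` (S - {x})"
      using orb by (auto simp: image_image)
    \<comment> \<open>Two orbits that agree off \<open>x\<close> share the point \<open>a\<close>,
      hence coincide.\<close>
    moreover have "inj_on (\<lambda>A. A - {x}) (orbit p ` (S - {x}))"
    proof (rule inj_onI)
      fix A B assume "A \<in> orbit p ` (S - {x})" "B \<in> orbit p ` (S - {x})" and AB: "A - {x} = B - {x}"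
      then obtain a b where ab: "A = orbit p a" "B = orbit p b" "a \<in> S" "a \<noteq> x" "b \<in> S" by auto
      have "a \<in> orbit p b" using self[OF ab(3)] ab AB by auto
      then have "cyclic_on p (orbit p b)" "a \<in> orbit p b"
        using self[OF ab(5)] by (auto simp: cyclic_on_def)
      then show "A = B" using ab orbit_cyclic_eq3 by metis
    qed
    ultimately show ?thesis by (simp add: card_image)
  qed
  ultimately show ?thesis by (simp add: q_def[abs_def])
qed

lemma card_orbits_fixpoint:
  assumes inj: "inj_on p S" and p: "p ` S \<subseteq> S" and fin: "finite S"
    and x: "x \<in> S" "p x = x"
  shows "card (orbit p ` S) = card (orbit p ` (S - {x})) + 1"
proof -
  have "p ` (S - {x}) \<subseteq> S - {x}" using inj p x by (auto simp: inj_on_def)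
  then have "orbit p y \<subseteq> S - {x}" if "y \<in> S - {x}" for y
  proof (intro subsetI)
    fix z assume "z \<in> orbit p y"
    then show "z \<in> S - {x}" by induction (use that \<open>p ` (S - {x}) \<subseteq> S - {x}\<close> in auto)
  qed
  moreover have "x \<in> orbit p x" using orbit.base[of p x] x by simp
  ultimately have "orbit p x \<notin> orbit p ` (S - {x})" by blast
  moreover have "orbit p ` S = insert (orbit p x) (orbit p ` (S - {x}))" using x by auto
  ultimately show ?thesis using fin by simp
qed

section \<open>Cycles and fixed points under the two constructions\<close>

lemma cyc_inc:
  assumes q: "q permutes {1..n}"
  shows "cyc (Suc n) (inc q) = cyc n q + 1"
proof -
  have i: "inc q permutes {1..Suc n}" by (rule inc_permutes[OF q])
  have "cyc (Suc n) (inc q) = card (orbit (inc q) ` ({1..Suc n} - {1})) + 1"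
    unfolding cyc_def
    by (rule card_orbits_fixpoint) (use permutes_inj_on[OF i] permutes_image[OF i] in \<open>auto simp: inc_def\<close>)
  also have "{1..Suc n} - {1} = Suc ` {1..n}"
    by auto
  also have "card (orbit (inc q) ` Suc ` {1..n}) = cyc n q"
    unfolding cyc_def by (rule card_orbits_conjugate) (use permutes_image[OF q] in \<open>auto simp: inc_def\<close>)
  finally show ?thesis .
qed

text \<open>Bypassing the point 1 turns the value 1 into \<open>p 1 = 2\<close>; on the remaining
  points this is \<open>q\<close> shifted by 1.\<close>

lemma cyc_lay_1:
  assumes q: "q permutes {1..n}" and n: "1 \<le> n"
  shows "cyc (n + 1) (lay 1 q) = cyc n q"
proof -
  define p where "p = lay 1 q"
  have p: "p permutes {1..n + 1}" unfolding p_def by (rule lay_permutes[OF q n order_refl])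
  have p1: "p 1 = 2" by (simp add: p_def lay_def)
  let ?r = "\<lambda>y. if p y = 1 then p 1 else p y"
  have "cyc (n + 1) p = card (orbit ?r ` ({1..n + 1} - {1}))"
    unfolding cyc_def
    by (rule card_orbits_contract[symmetric])
       (use permutes_inj_on[OF p] permutes_image[OF p] n p1 in auto)
  also have "{1..n + 1} - {1} = (\<lambda>i. i + 1) ` {1..n}"
    by auto
  also have "card (orbit ?r ` (\<lambda>i. i + 1) ` {1..n}) = cyc n q"
    unfolding cyc_def
  proof (rule card_orbits_conjugate)
    fix i assume "i \<in> {1..n}"
    then show "?r (i + 1) = q i + 1" using perm_range(1)[OF q, of i] by (simp add: p_def lay_def)
  qed (use permutes_image[OF q] in auto)
  finally show ?thesis by (simp add: p_def)
qed

text \<open>The fixed point 2 is the extra cycle. Without it, bypassing 1 turns the value 1 into 3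
  and leaves \<open>q\<close> shifted by 2.\<close>

lemma cyc_lay_2:
  assumes q: "q permutes {1..n}" and n: "1 \<le> n"
  shows "cyc (n + 2) (lay 2 q) = cyc n q + 1"
proof -
  define p where "p = lay 2 q"
  have p: "p permutes {1..n + 2}" unfolding p_def by (rule lay_permutes[OF q n]) simp
  have p12: "p 1 = 3" "p 2 = 2" by (simp_all add: p_def lay_def)
  let ?r = "\<lambda>y. if p y = 1 then p 1 else p y"
  let ?S = "{1..n + 2} - {2}"
  have "cyc (n + 2) p = card (orbit p ` ?S) + 1"
    unfolding cyc_def
    by (rule card_orbits_fixpoint) (use permutes_inj_on[OF p] permutes_image[OF p] p12 in auto)
  also have "card (orbit p ` ?S) = card (orbit ?r ` (?S - {1}))"
  proof (rule card_orbits_contract[symmetric])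
    show "p ` ?S \<subseteq> ?S" using perm_eq_iff[OF p, of _ 2] p12 permutes_image[OF p] by auto
  qed (use permutes_inj_on[OF p] p12 n in auto)
  also have "?S - {1} = (\<lambda>i. i + 2) ` {1..n}"
    by (auto simp: image_iff Bex_def) presburger
  also have "card (orbit ?r ` (\<lambda>i. i + 2) ` {1..n}) = cyc n q"
    unfolding cyc_def
  proof (rule card_orbits_conjugate)
    fix i assume "i \<in> {1..n}"
    then show "?r (i + 2) = q i + 2" using perm_range(1)[OF q, of i] by (simp add: p_def lay_def)
  qed (use permutes_image[OF q] in \<open>auto simp: inj_on_def\<close>)
  finally show ?thesis by (simp add: p_def)
qed

text \<open>Bypassing 1 and then 2 turns the values 1 and 2 into 3 and 4; what remains is
  \<open>lay k q\<close> shifted by 2.\<close>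

lemma cyc_lay_Suc_Suc:
  assumes q: "q permutes {1..n}" and n: "1 \<le> n" and k: "1 \<le> k"
  shows "cyc (n + (k + 2)) (lay (k + 2) q) = cyc (n + k) (lay k q)"
proof -
  define p where "p = lay (k + 2) q"
  have p: "p permutes {1..n + (k + 2)}" unfolding p_def by (rule lay_permutes[OF q n]) simp
  have l: "lay k q permutes {1..n + k}" by (rule lay_permutes[OF q n k])
  have p12: "p 1 = 3" "p 2 = 4" using k by (simp_all add: p_def lay_def)
  define r where "r y = (if p y = 1 then p 1 else p y)" for y
  have r2: "r 2 = 4" by (simp add: r_def p12)
  let ?s = "\<lambda>y. if r y = 2 then r 2 else r y"
  let ?S = "{1..n + (k + 2)} - {1}"
  have "cyc (n + (k + 2)) p = card (orbit r ` ?S)"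
    unfolding cyc_def r_def
    by (rule card_orbits_contract[symmetric])
       (use permutes_inj_on[OF p] permutes_image[OF p] p12 n in auto)
  also have "\<dots> = card (orbit ?s ` (?S - {2}))"
  proof (rule card_orbits_contract[symmetric])
    \<comment> \<open>Removing 1 from the domain matters: \<open>r\<close> takes the value 3 at 1
      and again at the predecessor of 1.\<close>
    show "inj_on r ?S"
    proof (rule inj_onI)
      fix x y assume "x \<in> ?S" "y \<in> ?S" "r x = r y"
      then have "p x = p y" using perm_eq_iff[OF p, of x 1] perm_eq_iff[OF p, of y 1]
        by (auto simp: r_def simp del: One_nat_def split: if_splits)
      then show "x = y" using perm_eq_iff[OF p] by blast
    qed
    show "r ` ?S \<subseteq> ?S"
    proof (intro image_subsetI DiffI)
      fix y assume "y \<in> ?S"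
      then have "p y \<in> {1..n + (k + 2)}" using permutes_in_image[OF p] by blast
      then show "r y \<in> {1..n + (k + 2)}" "r y \<notin> {1}" using p12 n by (simp_all add: r_def)
    qed
  qed (use r2 n in auto)
  also have "?S - {2} = (\<lambda>i. i + 2) ` {1..n + k}"
    by (auto simp: image_iff Bex_def) presburger
  also have "card (orbit ?s ` (\<lambda>i. i + 2) ` {1..n + k}) = cyc (n + k) (lay k q)"
    unfolding cyc_def
  proof (rule card_orbits_conjugate)
    fix i assume i: "i \<in> {1..n + k}"
    show "?s (i + 2) = lay k q i + 2"
    proof (cases "k < i")
      case True
      then show ?thesis using perm_range(1)[OF q, of "i - k"] p12 r2 by (auto simp: r_def p_def lay_def)
    next
      case False
      then show ?thesis using i k p12 r2 by (auto simp: r_def p_def lay_def)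
    qed
  qed (use permutes_image[OF l] in \<open>auto simp: inj_on_def\<close>)
  finally show ?thesis by (simp add: p_def)
qed

text \<open>Steps of two preserve the count, so the parity of \<open>k\<close> decides between the
  cases 1 and 2.\<close>

lemma cyc_lay:
  assumes q: "q permutes {1..n}" and n: "1 \<le> n" and k: "1 \<le> k"
  shows "cyc (n + k) (lay k q) = cyc n q + (if even k then 1 else 0)"
  using k
proof (induction k rule: less_induct)
  case (less k)
  consider "k = 1" | "k = 2" | "k \<ge> 3" using less.prems by linarith
  then show ?case
  proof cases
    case 3
    define j where "j = k - 2"
    have "k = j + 2" "j < k" "1 \<le> j" using 3 by (auto simp: j_def)
    then show ?thesis using cyc_lay_Suc_Suc[OF q n, of j] less.IH[of j] by simp
  qed (use cyc_lay_1[OF q n] cyc_lay_2[OF q n] in auto)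
qed

text \<open>The fixed point \<open>1\<close> is discounted since \<open>lay\<close> destroys it.\<close>
definition fp_tail :: "nat \<Rightarrow> (nat \<Rightarrow> nat) \<Rightarrow> nat" where
  "fp_tail n q = card ({i \<in> {1..n}. q i = i} - {1})"

lemma fp_inc:
  assumes "q permutes {1..n}"
  shows "fp (Suc n) (inc q) = fp n q + 1" "fp_tail (Suc n) (inc q) = fp n q"
proof -
  have "{i \<in> {1..Suc n}. inc q i = i} - {1} = Suc ` {i \<in> {1..n}. q i = i}" (is "?A = ?B")
  proof (intro set_eqI iffI)
    fix i assume "i \<in> ?A"
    then have "i = Suc (i - 1)" "i - 1 \<in> {i \<in> {1..n}. q i = i}" by (auto simp: inc_def)
    then show "i \<in> ?B" by blast
  qed (auto simp: inc_def)
  then show t: "fp_tail (Suc n) (inc q) = fp n q"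
    unfolding fp_tail_def fp_def by (simp add: card_image)
  have "{i \<in> {1..Suc n}. inc q i = i} = insert 1 ({i \<in> {1..Suc n}. inc q i = i} - {1})"
    by (auto simp: inc_def)
  then have "fp (Suc n) (inc q) = card (insert 1 ({i \<in> {1..Suc n}. inc q i = i} - {1}))"
    unfolding fp_def by simp
  also have "\<dots> = Suc (fp_tail (Suc n) (inc q))"
    unfolding fp_tail_def by (rule card_insert_disjoint) auto
  finally have "fp (Suc n) (inc q) = Suc (fp_tail (Suc n) (inc q))" .
  then show "fp (Suc n) (inc q) = fp n q + 1" using t by simp
qed

text \<open>Among the first \<open>k\<close> positions only \<open>k\<close>, with value 2, can be
  fixed. Later, values and positions both move by \<open>k\<close>, except for the value 1, which
  stays behind.\<close>

lemma fp_lay: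
  assumes q: "q permutes {1..n}" and k: "1 \<le> k"
  shows "fp (n + k) (lay k q) = fp_tail n q + (if k = 2 then 1 else 0)"
proof -
  let ?T = "(\<lambda>i. i + k) ` ({i \<in> {1..n}. q i = i} - {1})"
  have "{i \<in> {1..n + k}. lay k q i = i} = (if k = 2 then {2} else {}) \<union> ?T" (is "?A = ?B")
  proof (intro set_eqI iffI)
    fix i assume i: "i \<in> ?A"
    consider "i < k" | "i = k" | "k < i" by linarith
    then show "i \<in> ?B"
    proof cases
      case 3
      then have "q (i - k) = i - k" "i - k \<noteq> 1" "i = (i - k) + k" "i - k \<in> {1..n}"
        using i k by (auto simp: lay_def split: if_splits)
      then show ?thesis by blast
    qed (use i k in \<open>auto simp: lay_def\<close>)
  qed (use k in \<open>auto simp: lay_def split: if_splits\<close>)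
  moreover have "card ?T = fp_tail n q" unfolding fp_tail_def by (simp add: card_image)
  moreover have "k = 2 \<Longrightarrow> 2 \<notin> ?T" by auto
  moreover have "finite ?T" by auto
  ultimately show ?thesis unfolding fp_def by auto
qed

section \<open>The bijective decomposition of the avoiders\<close>

lemma finite_av: "finite (av n)"
  by (rule finite_subset[OF _ finite_permutations[of "{1..n}"]]) (auto simp: av_def avoiders_def)

lemma av_0: "av 0 = {id}"
  by (auto simp: av_def avoiders_def contains_312_iff contains_4321_iff simp del: One_nat_def)

lemma av_fixing_1: "{p \<in> av (Suc n). p 1 = 1} = inc ` av n"
proof (intro set_eqI iffI)
  fix p assume "p \<in> {p \<in> av (Suc n). p 1 = 1}"
  then show "p \<in> inc ` av n" by (auto elim: av_eq_inc)
next
  fix p assume "p \<in> inc ` av n"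
  then show "p \<in> {p \<in> av (Suc n). p 1 = 1}" using inc_in_av by (auto simp: inc_def)
qed

lemma inj_on_inc_av: "inj_on inc (av n)"
  by (rule inj_onI) (rule inc_inj[OF av_permutes av_permutes])

text \<open>Injectivity holds because \<open>k\<close> is recovered as the position of the value 2.
  The range stops below \<open>n\<close> because the remaining avoider must be nonempty.\<close>

lemma bij_betw_lay_av:
  "bij_betw (\<lambda>(k, q). lay k q) (SIGMA k:{1..<n}. av (n - k)) {p \<in> av n. p 1 \<noteq> 1}"
  unfolding bij_betw_def
proof
  show "inj_on (\<lambda>(k, q). lay k q) (SIGMA k:{1..<n}. av (n - k))"
  proof (rule inj_onI, clarify)
    fix k q k' q'
    assume k: "k \<in> {1..<n}" "k' \<in> {1..<n}" and q: "q \<in> av (n - k)" "q' \<in> av (n - k')"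
      and eq: "lay k q = lay k' q'"
    have "lay k q permutes {1..n - k + k}"
      by (rule lay_permutes[OF av_permutes[OF q(1)]]) (use k in auto)
    moreover have "lay k q k = 2" "lay k' q' k' = 2" using k by (auto simp: lay_def)
    ultimately have "k = k'" using perm_eq_iff eq by metis
    then show "k = k' \<and> q = q'" using lay_inj[OF av_permutes[OF q(1)] av_permutes[OF q(2)]] eq k by auto
  qed
  show "(\<lambda>(k, q). lay k q) ` (SIGMA k:{1..<n}. av (n - k)) = {p \<in> av n. p 1 \<noteq> 1}"
  proof (intro equalityI subsetI)
    fix p assume "p \<in> (\<lambda>(k, q). lay k q) ` (SIGMA k:{1..<n}. av (n - k))"
    then obtain k q where "1 \<le> k" "k < n" "q \<in> av (n - k)" "p = lay k q" by auto
    then show "p \<in> {p \<in> av n. p 1 \<noteq> 1}" using lay_in_av[of q "n - k" k] by (auto simp: lay_def)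
  next
    fix p assume p: "p \<in> {p \<in> av n. p 1 \<noteq> 1}"
    then have "1 \<le> n" by (cases n) (auto simp: av_0)
    then obtain k q where "1 \<le> k" "k < n" "q \<in> av (n - k)" "p = lay k q"
      using p av_eq_lay[of p n] by auto
    then show "p \<in> (\<lambda>(k, q). lay k q) ` (SIGMA k:{1..<n}. av (n - k))" by force
  qed
qed

section \<open>Weighted sums and their generating functions\<close>

context
  fixes t u :: "'a::comm_ring_1"
begin

text \<open>This and the next two definitions are the coefficients of the series W, G and H, in an
  arbitrary commutative ring.\<close>

definition wsum :: "nat \<Rightarrow> 'a" where
  "wsum n = (\<Sum>p\<in>av n. t ^ cyc n p * u ^ fp n p)"

definition wsum_moved :: "nat \<Rightarrow> 'a" where
  "wsum_moved n = (\<Sum>p | p \<in> av n \<and> p 1 \<noteq> 1. t ^ cyc n p * u ^ fp n p)"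

definition wsum_tail :: "nat \<Rightarrow> 'a" where
  "wsum_tail n = (if n = 0 then 0 else \<Sum>p\<in>av n. t ^ cyc n p * u ^ fp_tail n p)"

text \<open>The factor contributed by the \<open>k\<close> prepended entries: the coefficients of
  L.\<close>

definition layer_weight :: "nat \<Rightarrow> 'a" where
  "layer_weight k = (if k = 0 then 0 else (if even k then t else 1) * (if k = 2 then u else 1))"

lemma sum_av_Suc:
  "(\<Sum>p\<in>av (Suc n). f p) = (\<Sum>q\<in>av n. f (inc q)) + (\<Sum>p | p \<in> av (Suc n) \<and> p 1 \<noteq> 1. f p)"
  for f :: "_ \<Rightarrow> 'a"
proof -
  have "(\<Sum>p\<in>av (Suc n). f p) =
      (\<Sum>p | p \<in> av (Suc n) \<and> p 1 = 1. f p) + (\<Sum>p | p \<in> av (Suc n) \<and> p 1 \<noteq> 1. f p)"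
    using finite_av by (subst sum.union_disjoint[symmetric]) (auto intro!: sum.cong)
  then show ?thesis
    unfolding av_fixing_1 by (simp add: sum.reindex[OF inj_on_inc_av])
qed

lemma wsum_0: "wsum 0 = 1"
  by (simp add: wsum_def av_0 cyc_def fp_def)

lemma wsum_Suc: "wsum (Suc n) = t * u * wsum n + wsum_moved (Suc n)"
proof -
  have "t ^ cyc (Suc n) (inc q) * u ^ fp (Suc n) (inc q) = t * u * (t ^ cyc n q * u ^ fp n q)"
    if "q \<in> av n" for q
    using cyc_inc fp_inc(1) av_permutes[OF that] by (simp add: algebra_simps)
  then show ?thesis
    unfolding wsum_def sum_av_Suc wsum_moved_def by (simp add: sum_distrib_left)
qed

lemma wsum_tail_Suc: "wsum_tail (Suc n) = t * wsum n + wsum_moved (Suc n)"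
proof -
  have "t ^ cyc (Suc n) (inc q) * u ^ fp_tail (Suc n) (inc q) = t * (t ^ cyc n q * u ^ fp n q)"
    if "q \<in> av n" for q
    using cyc_inc fp_inc(2) av_permutes[OF that] by (simp add: algebra_simps)
  moreover have "fp_tail n p = fp n p" if "p 1 \<noteq> 1" for n p
  proof -
    have "{i \<in> {1..n}. p i = i} - {1} = {i \<in> {1..n}. p i = i}" using that by auto
    then show ?thesis by (simp add: fp_tail_def fp_def)
  qed
  ultimately show ?thesis
    unfolding wsum_def wsum_tail_def sum_av_Suc wsum_moved_def by (simp add: sum_distrib_left)
qed

lemma wsum_moved_conv: "wsum_moved n = (\<Sum>k=0..n. layer_weight k * wsum_tail (n - k))"
proof -
  have "wsum_moved n =
      (\<Sum>(k, q)\<in>(SIGMA k:{1..<n}. av (n - k)). t ^ cyc n (lay k q) * u ^ fp n (lay k q))"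
    unfolding wsum_moved_def by (subst sum.reindex_bij_betw[OF bij_betw_lay_av, symmetric]) (simp add: case_prod_beta)
  also have "\<dots> = (\<Sum>k\<in>{1..<n}. \<Sum>q\<in>av (n - k). t ^ cyc n (lay k q) * u ^ fp n (lay k q))"
    by (subst sum.Sigma) (auto simp: finite_av)
  also have "\<dots> = (\<Sum>k\<in>{1..<n}. layer_weight k * wsum_tail (n - k))"
  proof (rule sum.cong)
    fix k assume k: "k \<in> {1..<n}"
    have "t ^ cyc n (lay k q) * u ^ fp n (lay k q) =
        layer_weight k * (t ^ cyc (n - k) q * u ^ fp_tail (n - k) q)" if "q \<in> av (n - k)" for q
      using cyc_lay[OF av_permutes[OF that], of k] fp_lay[OF av_permutes[OF that], of k] k
      by (auto simp: layer_weight_def algebra_simps)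
    then show "(\<Sum>q\<in>av (n - k). t ^ cyc n (lay k q) * u ^ fp n (lay k q)) =
        layer_weight k * wsum_tail (n - k)"
      using k by (simp add: wsum_tail_def sum_distrib_left)
  qed simp
  \<comment> \<open>Extending the range to a Cauchy product adds only zeros, since
    \<open>layer_weight 0\<close> and \<open>wsum_tail 0\<close> vanish.\<close>
  also have "\<dots> = (\<Sum>k=0..n. layer_weight k * wsum_tail (n - k))"
    by (rule sum.mono_neutral_left) (auto simp: layer_weight_def wsum_tail_def)
  finally show ?thesis .
qed

lemma wsum_gf:
  defines "T \<equiv> fps_const t" and "U \<equiv> fps_const u" and "z \<equiv> fps_X"
  shows "(Abs_fps wsum - 1) *
      (1 - z * (1 + T * U) - z^2 * (1 + T) + T * U * z^3 * (1 + T * U - T)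
         + T * z^4 * (U - 1) - T^2 * z^5 * (1 - U)^2) =
      T * U * z + T * z^2 * (1 - U) + T * U * z^3 * (T - T * U - 1) + T^2 * z^5 * (1 - U)^2"
proof -
  define W where "W = Abs_fps wsum"
  define G where "G = Abs_fps wsum_moved"
  define H where "H = Abs_fps wsum_tail"
  define L where "L = Abs_fps layer_weight"
  have G0: "wsum_moved 0 = 0" by (simp add: wsum_moved_conv layer_weight_def)
  have H0: "wsum_tail 0 = 0" by (simp add: wsum_tail_def)
  have W: "W = 1 + z * (T * U * W) + G"
  proof (rule fps_ext)
    fix n show "fps_nth W n = fps_nth (1 + z * (T * U * W) + G) n"
      by (cases n) (simp_all add: W_def G_def T_def U_def z_def wsum_0 wsum_Suc G0 mult.assoc)
  qed
  have H: "H = z * (T * W) + G"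
  proof (rule fps_ext)
    fix n show "fps_nth H n = fps_nth (z * (T * W) + G) n"
      by (cases n) (simp_all add: W_def G_def H_def T_def z_def wsum_tail_Suc G0 H0)
  qed
  have G: "G = L * H"
    by (rule fps_ext) (simp add: G_def L_def H_def fps_mult_nth wsum_moved_conv)
  \<comment> \<open>Multiplying by \<open>1 - z^2\<close> cancels the weights of period 2; the
    exceptional weight at 2 leaves the term with \<open>z^2 - z^4\<close>. From degree 5 on both
    sides vanish.\<close>
  have L: "L - z^2 * L = z + T * z^2 + T * (U - 1) * (z^2 - z^4)"
  proof (rule fps_ext)
    fix n :: nat
    consider "n = 0" | "n = 1" | "n = 2" | "n = 3" | "n = 4" | "n \<ge> 5" by linarith
    then show "fps_nth (L - z^2 * L) n = fps_nth (z + T * z^2 + T * (U - 1) * (z^2 - z^4)) n"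
      by cases (auto simp: L_def T_def U_def z_def fps_X_power_mult_nth layer_weight_def algebra_simps
        fps_X_power_mult_right_nth)
  qed
  let ?M = "z + T * z^2 + T * (U - 1) * (z^2 - z^4)"
  have G': "G = W - 1 - z * (T * U * W)" using W by (simp add: algebra_simps)
  \<comment> \<open>This clears the denominator of L. Substituting for \<open>H\<close> and
    \<open>G\<close> then leaves an equation linear in \<open>W\<close>, which expansion matches
    with the claim.\<close>
  have "(1 - z^2) * G = (L - z^2 * L) * H" using G by (simp add: algebra_simps)
  then have "(1 - z^2) * G - ?M * H = 0" unfolding L by simp
  then have "(1 - z^2) * (W - 1 - z * (T * U * W)) - ?M * (z * (T * W) + (W - 1 - z * (T * U * W))) = 0"
    unfolding H G' .
  moreover have "(1 - z^2) * (W - 1 - z * (T * U * W)) - ?M * (z * (T * W) + (W - 1 - z * (T * U * W))) =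
      (W - 1) * (1 - z * (1 + T * U) - z^2 * (1 + T) + T * U * z^3 * (1 + T * U - T)
         + T * z^4 * (U - 1) - T^2 * z^5 * (1 - U)^2) -
      (T * U * z + T * z^2 * (1 - U) + T * U * z^3 * (T - T * U - 1) + T^2 * z^5 * (1 - U)^2)"
    by (simp add: algebra_simps eval_nat_numeral)
  ultimately show ?thesis unfolding W_def[symmetric] by simp
qed

end

section \<open>From weighted sums to the series of the theorem\<close>

text \<open>Both indices are bounded by \<open>n\<close> wherever the count is nonzero, so these are
  finite sums; they group the avoiders by cycles and fixed points.\<close>

lemma Sum_any_avoider_count:
  fixes t u :: "'a::comm_ring_1"
  shows "Sum_any (\<lambda>k. Sum_any (\<lambda>m. of_nat (avoider_count n k m) * t ^ k * u ^ m)) = wsum t u n"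
proof -
  have "Sum_any (\<lambda>m. of_nat (avoider_count n k m) * t ^ k * u ^ m) =
      (\<Sum>m\<le>n. of_nat (avoider_count n k m) * t ^ k * u ^ m)" for k
  proof (rule Sum_any.expand_superset)
    show "{m. of_nat (avoider_count n k m) * t ^ k * u ^ m \<noteq> 0} \<subseteq> {..n}"
      using avoider_count_eq_0[of n k] by (force intro: ccontr)
  qed simp
  moreover have "Sum_any (\<lambda>k. \<Sum>m\<le>n. of_nat (avoider_count n k m) * t ^ k * u ^ m) =
      (\<Sum>k\<le>n. \<Sum>m\<le>n. of_nat (avoider_count n k m) * t ^ k * u ^ m)"
  proof (rule Sum_any.expand_superset)
    show "{k. (\<Sum>m\<le>n. of_nat (avoider_count n k m) * t ^ k * u ^ m) \<noteq> 0} \<subseteq> {..n}"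
      using avoider_count_eq_0[of n] by (force intro: ccontr)
  qed simp
  moreover have "(\<Sum>k\<le>n. \<Sum>m\<le>n. of_nat (avoider_count n k m) * t ^ k * u ^ m) = wsum t u n"
  proof -
    have "of_nat (avoider_count n k m) * t ^ k * u ^ m =
        (\<Sum>p | p \<in> {p \<in> av n. cyc n p = k} \<and> fp n p = m. t ^ cyc n p * u ^ fp n p)" for k m
    proof -
      have "{p \<in> av n. fp n p = m \<and> cyc n p = k} = {p. p \<in> {p \<in> av n. cyc n p = k} \<and> fp n p = m}"
        by auto
      then have "of_nat (avoider_count n k m) * t ^ k * u ^ m =
        (\<Sum>p | p \<in> {p \<in> av n. cyc n p = k} \<and> fp n p = m. t ^ k * u ^ m)"
        unfolding avoider_count_def av_def[symmetric] by (simp add: mult.assoc)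
      also have "\<dots> = (\<Sum>p | p \<in> {p \<in> av n. cyc n p = k} \<and> fp n p = m. t ^ cyc n p * u ^ fp n p)"
        by (rule sum.cong) auto
      finally show ?thesis .
    qed
    moreover have "(\<Sum>m\<le>n. \<Sum>p | p \<in> {p \<in> av n. cyc n p = k} \<and> fp n p = m. t ^ cyc n p * u ^ fp n p)
        = (\<Sum>p | p \<in> av n \<and> cyc n p = k. t ^ cyc n p * u ^ fp n p)" for k
      by (rule sum.group) (use finite_av[of n] fp_le in auto)
    moreover have "(\<Sum>k\<le>n. \<Sum>p | p \<in> av n \<and> cyc n p = k. t ^ cyc n p * u ^ fp n p) = wsum t u n"
      unfolding wsum_def by (rule sum.group) (use finite_av[of n] cyc_le in auto)
    ultimately show ?thesis by simp
  qed
  ultimately show ?thesis by simp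
qed

text \<open>Subtracting 1 removes the empty permutation.\<close>

lemma C_gf_eq: "C_gf = Abs_fps (wsum t_var u_var) - 1"
proof (rule fps_ext)
  fix n
  show "fps_nth C_gf n = fps_nth (Abs_fps (wsum t_var u_var) - 1) n"
    by (cases n) (simp_all add: C_gf_def Sum_any_avoider_count wsum_0)
qed

lemma fps_quot_eqI:
  assumes "f * g = h" "fps_nth g 0 = 1"
  shows "f = fps_quot h g"
proof -
  have "fps_quot h g = f * (g * fps_right_inverse g 1)"
    by (simp add: fps_quot_def assms(1)[symmetric] mult.assoc)
  then show ?thesis using fps_right_inverse[of g 1] assms(2) by simp
qed

theorem theorem10:
  shows "let t = fps_const t_var; u = fps_const u_var; z = fps_X in
    C_gf = fps_quot
      (t * u * z + t * z^2 * (1 - u) + t * u * z^3 * (t - t * u - 1) + t^2 * z^5 * (1 - u)^2)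
      (1 - z * (1 + t * u) - z^2 * (1 + t) + t * u * z^3 * (1 + t * u - t)
         + t * z^4 * (u - 1) - t^2 * z^5 * (1 - u)^2)"
  unfolding Let_def C_gf_eq
  \<comment> \<open>The remaining goal is that the divisor has constant coefficient 1.\<close>
  by (rule fps_quot_eqI[OF wsum_gf]) (simp add: fps_X_power_mult_right_nth)

end
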